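(* Let $P_n$ be the path with vertices $v_1,\dots,v_n$ and edges $v_iv_{i+1}$ ($1\le i\le n-1$), let $L_{P_n}$ be its Laplacian matrix, and let $B_{P_n}=(L_{P_n}+I_n)^{-1}=[b_{ij}]$. Then $B_{P_n}$ is $d$-monotone, i.e. \[ b_{i1}<b_{i2}<\cdots<b_{i,i-1}<b_{ii}>b_{i,i+1}>\cdots>b_{in}\qquad(1\le i\le n). \] In fact the following stronger property holds: \[ b_{ij}\ge 2\,b_{i,j+1}\quad(1\le i\le j\le n-1),\qquad b_{ij}\ge 2\,b_{i,j-1}\quad (2\le j\le i\le n). \]
   Context: The Laplacian matrix of a simple graph $G$ is $L_G=D-A$, where $A$ is the adjacency matrix and $D$ is the diagonal matrix of vertex degrees; row/column $i$ corresponds to vertex $v_i$. The matrix $L_G+I_n$ is positive definite, hence invertible. *)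

theory Defs
  imports "Jordan_Normal_Form.Gauss_Jordan_Elimination"
begin

text \<open>A simple graph on the vertices \<open>v\<^sub>1, \<dots>, v\<^sub>n\<close> is given by \<open>n\<close> and its set \<open>E\<close> of edges,
  an edge being a two-element subset of \<open>{1..n}\<close>. Library matrices are indexed from \<open>0\<close>, so
  row/column \<open>i\<close> of a matrix belongs to the vertex \<open>v\<close> with index \<open>Suc i\<close>.\<close>

definition adjacency_matrix :: "nat \<Rightarrow> nat set set \<Rightarrow> real mat" where
  "adjacency_matrix n E = mat n n (\<lambda>(i, j). if {Suc i, Suc j} \<in> E then 1 else 0)"

definition vertex_degree :: "nat set set \<Rightarrow> nat \<Rightarrow> nat" where
  "vertex_degree E v = card {e \<in> E. v \<in> e}"

definition degree_matrix :: "nat \<Rightarrow> nat set set \<Rightarrow> real mat" where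
  "degree_matrix n E = mat_diag n (\<lambda>i. real (vertex_degree E (Suc i)))"

definition laplacian_matrix :: "nat \<Rightarrow> nat set set \<Rightarrow> real mat" where
  "laplacian_matrix n E = degree_matrix n E - adjacency_matrix n E"

definition path_edges :: "nat \<Rightarrow> nat set set" where
  "path_edges n = {{i, i + 1} | i. 1 \<le> i \<and> i \<le> n - 1}"

text \<open>The entry \<open>b\<^sub>i\<^sub>j\<close> in the usual numbering, meaningful for \<open>i, j \<ge> 1\<close>.\<close>

definition entry :: "real mat \<Rightarrow> nat \<Rightarrow> nat \<Rightarrow> real" where
  "entry B i j = B $$ (i - 1, j - 1)"

definition d_monotone :: "nat \<Rightarrow> real mat \<Rightarrow> bool" where
  "d_monotone n B \<longleftrightarrow>
    (\<forall>i\<in>{1..n}.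
      (\<forall>j. 1 \<le> j \<and> j < i \<longrightarrow> entry B i j < entry B i (j + 1)) \<and>
      (\<forall>j. i \<le> j \<and> j < n \<longrightarrow> entry B i j > entry B i (j + 1)))"

end

theory Submission
  imports Defs "Jordan_Normal_Form.Determinant"
begin

text \<open>With the convention \<open>x\<^sub>0 = x\<^sub>1\<close> and \<open>x\<^sub>n\<^sub>+\<^sub>1 = x\<^sub>n\<close>, the matrix \<open>L + I\<close> of the path acts as
  \<open>x\<^sub>i \<mapsto> 3 x\<^sub>i - x\<^sub>i\<^sub>-\<^sub>1 - x\<^sub>i\<^sub>+\<^sub>1\<close>. The sequence \<open>v = 1, 1, 2, 5, 13, \<dots>\<close> (every other Fibonacci number)
  is annihilated by this operator and satisfies the left boundary condition; its reversal satisfies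
  the right one. Hence the inverse is the discrete Green function
  \<open>v\<^sub>m\<^sub>i\<^sub>n\<^sub>(\<^sub>i\<^sub>,\<^sub>j\<^sub>) v\<^sub>n\<^sub>+\<^sub>1\<^sub>-\<^sub>m\<^sub>a\<^sub>x\<^sub>(\<^sub>i\<^sub>,\<^sub>j\<^sub>) / W\<close>, where \<open>W\<close> is the (constant) Wronskian, and the claimed
  inequalities reduce to \<open>v\<^sub>k\<^sub>+\<^sub>1 \<ge> 2 v\<^sub>k > 0\<close> for \<open>k \<ge> 1\<close>.\<close>

fun path_seq :: "nat \<Rightarrow> real" where
  "path_seq 0 = 1"
| "path_seq (Suc 0) = 1"
| "path_seq (Suc (Suc k)) = 3 * path_seq (Suc k) - path_seq k"

lemma path_seq_pos_mono: "0 < path_seq k \<and> path_seq k \<le> path_seq (Suc k)"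
  by (induction k) auto

lemma path_seq_pos: "0 < path_seq k"
  using path_seq_pos_mono by blast

text \<open>The excess over doubling is \<open>path_seq k - path_seq (k - 1)\<close>, nonnegative by
  monotonicity. At \<open>k = 0\<close> doubling fails, both values being 1.\<close>

lemma path_seq_double: "1 \<le> k \<Longrightarrow> 2 * path_seq k \<le> path_seq (Suc k)"
  using path_seq_pos_mono[of "k - 1"] by (cases k) auto

lemma path_seq_Suc: "1 \<le> k \<Longrightarrow> path_seq (Suc k) = 3 * path_seq k - path_seq (k - 1)"
  by (cases k) auto

text \<open>By the recurrence, applied once in each factor, the left side is unchanged when one unit
  of index moves from \<open>i\<close> to \<open>m\<close>; at \<open>i = 0\<close> the initial
  values give the claim.\<close>

lemma path_seq_wronskian:
  "path_seq (Suc i) * path_seq (Suc m) - path_seq i * path_seq m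
    = path_seq (Suc (i + m)) - path_seq (i + m)"
proof (induction i arbitrary: m)
  case 0
  then show ?case by simp
next
  case (Suc i)
  have "path_seq (Suc (Suc i)) * path_seq (Suc m) - path_seq (Suc i) * path_seq m
      = path_seq (Suc i) * path_seq (Suc (Suc m)) - path_seq i * path_seq (Suc m)"
    by (simp add: algebra_simps)
  then show ?case using Suc.IH[of "Suc m"] by simp
qed

definition path_green :: "nat \<Rightarrow> nat \<Rightarrow> nat \<Rightarrow> real" where
  "path_green n i j =
    path_seq (min i j) * path_seq (n + 1 - max i j) / (path_seq (Suc n) - path_seq n)"

lemma path_wronskian_pos:
  assumes "1 \<le> n"
  shows "0 < path_seq (Suc n) - path_seq n"
  using path_seq_double[OF assms] path_seq_pos[of n] by simp

lemma path_green_pos: "1 \<le> n \<Longrightarrow> 0 < path_green n i j"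
  using path_wronskian_pos by (simp add: path_green_def path_seq_pos)

text \<open>Both ends come down to \<open>path_seq 0 = path_seq 1\<close>: at the left end these are
  the values of the first factor, at the right end those of the second. The fictitious rows
  \<open>0\<close> and \<open>Suc n\<close> let the end vertices be treated like interior
  ones.\<close>

lemma path_green_boundary:
  assumes "1 \<le> j" "j \<le> n"
  shows "path_green n 0 j = path_green n 1 j"
    and "path_green n (Suc n) j = path_green n n j"
  using assms by (simp_all add: path_green_def min_def max_def)

text \<open>Off the diagonal one factor is constant on the three rows involved and the recurrence
  annihilates the other. On the diagonal \<open>min\<close> and \<open>max\<close> change branch,
  which leaves the Wronskian.\<close>

lemma path_green_recurrence:
  assumes "1 \<le> i" "i \<le> n" "1 \<le> j" "j \<le> n"
  shows "3 * path_green n i j - path_green n (i - 1) j - path_green n (Suc i) j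
    = (if i = j then 1 else 0)"
proof -
  define W where "W = path_seq (Suc n) - path_seq n"
  have W: "W \<noteq> 0" using path_wronskian_pos[of n] assms by (simp add: W_def)
  obtain k where k: "i = Suc k" using assms by (cases i) auto
  obtain m where m: "n = i + m" using assms by (metis le_Suc_ex)
  consider "i < j" | "j < i" | "i = j" by linarith
  then show ?thesis
  proof cases
    case 1
    then have eqs: "path_green n (Suc i) j = path_seq (Suc i) * path_seq (n + 1 - j) / W"
      "path_green n i j = path_seq i * path_seq (n + 1 - j) / W"
      "path_green n (i - 1) j = path_seq (i - 1) * path_seq (n + 1 - j) / W"
      by (simp_all add: path_green_def W_def min_absorb1 max_absorb2)
    show ?thesis unfolding eqs using 1 W by (simp add: k field_simps)
  next
    case 2
    then have eqs: "path_green n (Suc i) j = path_seq j * path_seq m / W"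
      "path_green n i j = path_seq j * path_seq (Suc m) / W"
      "path_green n (i - 1) j = path_seq j * path_seq (Suc (Suc m)) / W"
      by (simp_all add: path_green_def W_def min_absorb2 max_absorb1 Suc_diff_le k m)
    show ?thesis unfolding eqs using 2 W by (simp add: field_simps)
  next
    case 3
    then have "path_green n (Suc i) j = path_seq i * path_seq m / W"
      "path_green n i j = path_seq i * path_seq (Suc m) / W"
      "path_green n (i - 1) j = path_seq (i - 1) * path_seq (Suc m) / W"
      by (simp_all add: path_green_def W_def min_def max_def k m)
    \<comment> \<open>The first two terms combine to
      \<open>path_seq (Suc i) * path_seq (Suc m)\<close>; the Wronskian identity then applies with
      \<open>i + m = n\<close>.\<close>
    moreover have "3 * (path_seq i * path_seq (Suc m)) - path_seq (i - 1) * path_seq (Suc m)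
        - path_seq i * path_seq m = W"
      using path_seq_wronskian[of i m] by (simp add: W_def m k algebra_simps)
    ultimately show ?thesis using 3 W by (simp add: diff_divide_distrib[symmetric])
  qed
qed

lemma path_green_decreasing:
  assumes "1 \<le> i" "i \<le> j" "j < n"
  shows "2 * path_green n i (j + 1) \<le> path_green n i j"
proof -
  have "2 * path_seq (n - j) \<le> path_seq (Suc (n - j))"
    using assms by (intro path_seq_double) simp
  then have "path_seq i * (2 * path_seq (n - j)) \<le> path_seq i * path_seq (Suc (n - j))"
    using path_seq_pos[of i] by (intro mult_left_mono) auto
  then show ?thesis
    using path_wronskian_pos[of n] assms
    by (simp add: path_green_def min_absorb1 max_absorb2 Suc_diff_le divide_right_mono)
qed

lemma path_green_increasing:
  assumes "2 \<le> j" "j \<le> i" "i \<le> n"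
  shows "2 * path_green n i (j - 1) \<le> path_green n i j"
proof -
  have "2 * path_seq (j - 1) \<le> path_seq j"
    using assms path_seq_double[of "j - 1"] by simp
  then have "2 * path_seq (j - 1) * path_seq (n + 1 - i) \<le> path_seq j * path_seq (n + 1 - i)"
    using path_seq_pos[of "n + 1 - i"] by (intro mult_right_mono) auto
  then show ?thesis
    using path_wronskian_pos[of n] assms
    by (simp add: path_green_def min_absorb2 max_absorb1 divide_right_mono)
qed

lemma path_edges_iff:
  "{a, b} \<in> path_edges n \<longleftrightarrow> (b = a + 1 \<and> 1 \<le> a \<and> a < n) \<or> (a = b + 1 \<and> 1 \<le> b \<and> b < n)"
  unfolding path_edges_def by (auto simp: doubleton_eq_iff)

lemma vertex_degree_path:
  assumes "1 \<le> v" "v \<le> n"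
  shows "vertex_degree (path_edges n) v = (if 1 < v then 1 else 0) + (if v < n then 1 else 0)"
proof -
  have "{e \<in> path_edges n. v \<in> e}
      = (if 1 < v then {{v - 1, v}} else {}) \<union> (if v < n then {{v, v + 1}} else {})"
    (is "?L = ?R")
  proof
    show "?L \<subseteq> ?R"
      by (auto simp: path_edges_def)
    show "?R \<subseteq> ?L"
      using assms by (auto simp: path_edges_iff)
  qed
  moreover have "{v - 1, v} \<noteq> {v, v + 1}"
    by (auto simp: doubleton_eq_iff)
  ultimately show ?thesis
    by (simp add: vertex_degree_def)
qed

lemma laplacian_plus_one_carrier:
  "laplacian_matrix n E + 1\<^sub>m n \<in> carrier_mat n n"
  by (auto simp: laplacian_matrix_def adjacency_matrix_def)

text \<open>Separate indicators make a row-times-column sum split into sums with at most one nonzero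
  term; \<open>Suc k = i\<close> avoids truncated subtraction at \<open>i = 0\<close>.\<close>

lemma path_laplacian_plus_one_index:
  assumes "i < n" "k < n"
  shows "(laplacian_matrix n (path_edges n) + 1\<^sub>m n) $$ (i, k) =
    (if k = i then 1 + (if 0 < i then 1 else 0) + (if Suc i < n then 1 else 0) else 0)
    - (if k = Suc i then 1 else 0) - (if Suc k = i then 1 else 0)"
  using assms
  by (auto simp: laplacian_matrix_def adjacency_matrix_def degree_matrix_def mat_diag_def
      path_edges_iff vertex_degree_path)

definition path_green_mat :: "nat \<Rightarrow> real mat" where
  "path_green_mat n = mat n n (\<lambda>(i, j). path_green n (Suc i) (Suc j))"

lemma path_green_mat_carrier: "path_green_mat n \<in> carrier_mat n n"
  by (simp add: path_green_mat_def)

lemma path_green_mat_right_inverse: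
  "(laplacian_matrix n (path_edges n) + 1\<^sub>m n) * path_green_mat n = 1\<^sub>m n" (is "?A * ?B = _")
proof (rule eq_matI)
  fix i j assume "i < dim_row (1\<^sub>m n :: real mat)" "j < dim_col (1\<^sub>m n :: real mat)"
  then have ij: "i < n" "j < n" by auto
  let ?g = "\<lambda>k. path_green n k (Suc j)"
  have "(?A * ?B) $$ (i, j) = (\<Sum>k<n. ?A $$ (i, k) * ?B $$ (k, j))"
  proof -
    have "dim_row ?A = n" "dim_col ?A = n" "dim_row ?B = n" "dim_col ?B = n"
      using laplacian_plus_one_carrier[of n "path_edges n"] path_green_mat_carrier[of n]
      by (blast dest: carrier_matD)+
    with ij show ?thesis
      by (simp add: times_mat_def scalar_prod_def atLeast0LessThan del: index_add_mat)
  qed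
  also have "\<dots> = (\<Sum>k<n.
      (if k = i then (1 + (if 0 < i then 1 else 0) + (if Suc i < n then 1 else 0)) * ?g (Suc k) else 0)
      - (if k = Suc i then ?g (Suc k) else 0) - (if Suc k = i then ?g (Suc k) else 0))"
    using ij by (intro sum.cong refl)
      (subst path_laplacian_plus_one_index, auto simp: path_green_mat_def)
  also have "\<dots> = (1 + (if 0 < i then 1 else 0) + (if Suc i < n then 1 else 0)) * ?g (Suc i)
      - (if Suc i < n then ?g (Suc (Suc i)) else 0)
      - (\<Sum>k<n. if Suc k = i then ?g (Suc k) else 0)"
    using ij by (simp add: sum_subtractf)
  also have "(\<Sum>k<n. if Suc k = i then ?g (Suc k) else 0) = (if 0 < i then ?g i else 0)"
    using ij by (cases i) (simp_all)
  \<comment> \<open>At an end vertex the diagonal coefficient is one smaller and a neighbour term is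
    absent; since the fictitious value equals the end value, the two omissions cancel.\<close>
  also have "(1 + (if 0 < i then 1 else 0) + (if Suc i < n then 1 else 0)) * ?g (Suc i)
      - (if Suc i < n then ?g (Suc (Suc i)) else 0) - (if 0 < i then ?g i else 0)
      = 3 * ?g (Suc i) - ?g i - ?g (Suc (Suc i))"
  proof -
    have "?g (Suc (Suc i)) = ?g (Suc i)" if "\<not> Suc i < n"
    proof -
      have "n = Suc i" using that ij by simp
      then show ?thesis using ij path_green_boundary(2)[of "Suc j" n] by simp
    qed
    moreover have "?g i = ?g (Suc i)" if "i = 0"
      using that ij path_green_boundary(1)[of "Suc j" n] by simp
    ultimately show ?thesis by (auto simp: algebra_simps)
  qed
  also have "\<dots> = 1\<^sub>m n $$ (i, j)"
    using path_green_recurrence[of "Suc i" n "Suc j"] ij by simp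
  finally show "(?A * ?B) $$ (i, j) = 1\<^sub>m n $$ (i, j)" .
qed (auto simp: laplacian_matrix_def adjacency_matrix_def path_green_mat_def)

text \<open>A one-sided inverse of a square matrix over a field is two-sided, so \<open>A\<close> is
  a unit and \<open>None\<close> is impossible; any returned \<open>C\<close> equals
  \<open>C * (A * B) = B\<close>.\<close>

lemma mat_inverse_eq_Some:
  fixes A B :: "'a :: field mat"
  assumes A: "A \<in> carrier_mat n n" and B: "B \<in> carrier_mat n n" and AB: "A * B = 1\<^sub>m n"
  shows "mat_inverse A = Some B"
proof (cases "mat_inverse A")
  case None
  have "B * A = 1\<^sub>m n"
    using mat_mult_left_right_inverse[OF A B AB] .
  then have "A \<in> Units (ring_mat TYPE('a) n ())"
    using A B AB by (auto simp: Units_def ring_mat_def)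
  then show ?thesis
    using mat_inverse(1)[OF A None, where b = "()"] by blast
next
  case (Some C)
  have C: "C * A = 1\<^sub>m n" "C \<in> carrier_mat n n"
    using mat_inverse(2)[OF A Some] by auto
  have "C = C * (A * B)" using C AB by simp
  also have "\<dots> = C * A * B" using assoc_mult_mat[OF C(2) A B] by simp
  also have "\<dots> = B" using B C by simp
  finally show ?thesis using Some by simp
qed

theorem theorem2p3:
  fixes n :: nat
  assumes "n \<ge> 1"
  shows "\<exists>B. mat_inverse (laplacian_matrix n (path_edges n) + 1\<^sub>m n) = Some B \<and>
    d_monotone n B \<and>
    (\<forall>i j. 1 \<le> i \<and> i \<le> j \<and> j \<le> n - 1 \<longrightarrow> entry B i j \<ge> 2 * entry B i (j + 1)) \<and>
    (\<forall>i j. 2 \<le> j \<and> j \<le> i \<and> i \<le> n \<longrightarrow> entry B i j \<ge> 2 * entry B i (j - 1))"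
proof (intro exI conjI allI impI)
  let ?B = "path_green_mat n"
  have entry: "entry ?B i j = path_green n i j" if "1 \<le> i" "i \<le> n" "1 \<le> j" "j \<le> n" for i j
    using that by (simp add: entry_def path_green_mat_def)
  show "mat_inverse (laplacian_matrix n (path_edges n) + 1\<^sub>m n) = Some ?B"
    by (rule mat_inverse_eq_Some[OF laplacian_plus_one_carrier path_green_mat_carrier
          path_green_mat_right_inverse])
  show dec: "2 * entry ?B i (j + 1) \<le> entry ?B i j" if "1 \<le> i \<and> i \<le> j \<and> j \<le> n - 1" for i j
  proof -
    have "1 \<le> i" "i \<le> j" "j < n" using that assms by auto
    then show ?thesis using path_green_decreasing[of i j n] by (simp add: entry)
  qed
  show inc: "2 * entry ?B i (j - 1) \<le> entry ?B i j" if "2 \<le> j \<and> j \<le> i \<and> i \<le> n" for i j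
  proof -
    have "2 \<le> j" "j \<le> i" "i \<le> n" using that by auto
    then show ?thesis using path_green_increasing[of j i n] by (simp add: entry)
  qed
  \<comment> \<open>Positivity turns the factor-two bounds into the strict inequalities of
    \<open>d_monotone\<close>.\<close>
  have pos: "0 < entry ?B i j" if "1 \<le> i" "i \<le> n" "1 \<le> j" "j \<le> n" for i j
    using that assms by (simp add: entry path_green_pos)
  show "d_monotone n ?B"
    unfolding d_monotone_def
  proof (intro ballI conjI allI impI)
    fix i j assume i: "i \<in> {1..n}"
    show "entry ?B i j < entry ?B i (j + 1)" if "1 \<le> j \<and> j < i"
      using inc[of "j + 1" i] pos[of i j] i that by simp
    show "entry ?B i (j + 1) < entry ?B i j" if "i \<le> j \<and> j < n"
    proof -
      have "1 \<le> i" "i \<le> j" "j \<le> n - 1" "j + 1 \<le> n" using i that by auto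
      then show ?thesis using dec[of i j] pos[of i "j + 1"] by simp
    qed
  qed
qed

end
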